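(* $[2,0,1,0]=4$. More precisely: let $n\ge 2$ and let $r,r_1,g,g_1$ be two (distinct) red vertices $r,r_1$ and two (distinct) green vertices $g,g_1$ in $\mathcal{Q}_n$. If $n=2$ or $n\ge 4$, then there exists a Hamiltonian path of $\mathcal{Q}_n-\{r_1,g_1\}$ connecting $r$ to $g$. If $n=3$, the same conclusion follows provided $\{r,g\}\notin\mathcal{B}_{\{r_1,g_1\}}$.
   Context: $\mathcal{Q}_n$ is the $n$-dimensional binary hypercube: its vertices are all binary sequences of length $n$, adjacent iff they differ in exactly one position. A vertex is even or odd according to the parity of its number of 1's; vertices of one parity are called red and those of the other parity green. For a vertex $a$ of $\mathcal{Q}_n$, $\bar a$ denotes the unique vertex at distance $n$ from $a$ (all coordinates negated). For a red vertex $r$ and a green vertex $g$ of $\mathcal{Q}_3$, the set $\mathcal{B}_{\{r,g\}}$ of pairs of vertices is defined as follows: if $r=\bar g$, then for a red vertex $r'$ and a green vertex $g'$, $\{r',g'\}\in\mathcal{B}_{\{r,g\}}$ iff $\{r',g'\}\ne\{r,g\}$ and $r'=\bar{g'}$; if $r\ne\bar g$, then $\mathcal{B}_{\{r,g\}}=\{\{\bar r,\bar g\}\}$. A path covering of a graph is a set of vertex-disjoint paths that cover all vertices of the graph. A fault $\mathcal{F}$ in $\mathcal{Q}_n$ is a set of deleted vertices; its mass is $|\mathcal{F}|$ and its charge is $|r(\mathcal{F})-g(\mathcal{F})|$, where $r(\mathcal{F})$, $g(\mathcal{F})$ are the numbers of red and green vertices in $\mathcal{F}$. $\mathcal{Q}_n-\mathcal{F}$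 is the subgraph induced by the non-deleted vertices. A pair of vertices (or a path, via its two endpoints) is neutral if the two vertices have opposite parity and charged if they have the same parity; a charged pair is red (green) if its elements are red (green). A set $\mathcal{E}$ of disjoint pairs of vertices is in balance with $\mathcal{F}$ if all vertices in the pairs lie in $\mathcal{Q}_n-\mathcal{F}$ and $r(\mathcal{F})-g(\mathcal{F})=g(\mathcal{E})-r(\mathcal{E})$, where $r(\mathcal{E})$, $g(\mathcal{E})$ are the numbers of red and green pairs in $\mathcal{E}$. For a fault $\mathcal{F}$ of mass $M$ and charge $C$ in $\mathcal{Q}_n$, one can freely prescribe ends for a path covering of $\mathcal{Q}_n-\mathcal{F}$ with $N$ neutral paths and $O$ charged paths if (i) there is at least one set $\mathcal{E}$ of disjoint pairs of vertices in balance with $\mathcal{F}$ containing exactly $N$ neutral and $O$ charged pairs, and (ii) for every such $\mathcal{E}$ there is a path covering of $\mathcal{Q}_n-\mathcal{F}$ whose set of pairs of end vertices is $\mathcal{E}$. For nonnegative integers $M,C,N,O$, $\mathcal{A}_{M,C,N,O}$ is the set of nonnegative integers $m$ such that $m\ge\log_2[M+C+2N+2O]$ and for every $n\ge m$ and every fault $\mathcal{F}$ of mass $M$ and charge $C$ in $\mathcal{Q}_n$ one can freely prescribe ends for a path covering of $\mathcal{Q}_n-\mathcal{F}$ with $N$ neutral and $O$ charged paths. $[M,C,N,O]$ is the smallest element of $\mathcal{A}_{M,C,N,O}$ if this set is nonempty. *)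

theory Defs
  imports Complex_Main
begin

text \<open>The hypercube \<open>Q\<^sub>n\<close>: the vertex set is \<open>cube n\<close>, the adjacency relation is \<open>adj\<close>.\<close>

type_synonym vertex = "bool list"

definition cube :: "nat \<Rightarrow> vertex set" where
  "cube n = {v. length v = n}"

definition adj :: "vertex \<Rightarrow> vertex \<Rightarrow> bool" where
  "adj u v \<longleftrightarrow> length u = length v \<and> card {i. i < length u \<and> u ! i \<noteq> v ! i} = 1"

definition antipode :: "vertex \<Rightarrow> vertex" where
  "antipode v = map Not v"

definition even_vertex :: "vertex \<Rightarrow> bool" where
  "even_vertex v \<longleftrightarrow> even (count_list v True)"

text \<open>Which of the two parities is called red is a free convention. It is recorded by the
  parameter \<open>c\<close>: the red vertices are the even ones if \<open>c\<close> holds, and the odd ones otherwise.\<close>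

definition red :: "bool \<Rightarrow> vertex \<Rightarrow> bool" where
  "red c v \<longleftrightarrow> (even_vertex v \<longleftrightarrow> c)"

definition green :: "bool \<Rightarrow> vertex \<Rightarrow> bool" where
  "green c v \<longleftrightarrow> \<not> red c v"

text \<open>The set of pairs \<open>B\<^bsub>{r,g}\<^esub>\<close>, for a red vertex \<open>r\<close> and a green vertex \<open>g\<close> of \<open>Q\<^sub>3\<close>.
  A pair of vertices is an unordered pair, that is, a two-element set.\<close>

definition bad_pairs :: "bool \<Rightarrow> vertex \<Rightarrow> vertex \<Rightarrow> vertex set set" where
  "bad_pairs c r g =
    (if r = antipode g
     then {{r', g'} | r' g'. r' \<in> cube 3 \<and> g' \<in> cube 3 \<and> red c r' \<and> green c g' \<and>
                             {r', g'} \<noteq> {r, g} \<and> r' = antipode g'}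
     else {{antipode r, antipode g}})"

text \<open>Paths of \<open>Q\<^sub>n - F\<close>, the subgraph induced by \<open>cube n - F\<close>, given by their vertex sequences.\<close>

definition is_path :: "nat \<Rightarrow> vertex set \<Rightarrow> vertex list \<Rightarrow> bool" where
  "is_path n F p \<longleftrightarrow> p \<noteq> [] \<and> distinct p \<and> set p \<subseteq> cube n - F \<and> successively adj p"

definition hamiltonian_path :: "nat \<Rightarrow> vertex set \<Rightarrow> vertex \<Rightarrow> vertex \<Rightarrow> vertex list \<Rightarrow> bool" where
  "hamiltonian_path n F u v p \<longleftrightarrow>
    is_path n F p \<and> set p = cube n - F \<and> hd p = u \<and> last p = v"

text \<open>A path can be listed in two directions, but a path covering never contains both listings,
  since its members have pairwise disjoint vertex sets.\<close>

definition path_covering :: "nat \<Rightarrow> vertex set \<Rightarrow> vertex list set \<Rightarrow> bool" where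
  "path_covering n F P \<longleftrightarrow>
    (\<forall>p\<in>P. is_path n F p) \<and> pairwise (\<lambda>p q. disjnt (set p) (set q)) P \<and>
    (\<Union>p\<in>P. set p) = cube n - F"

definition ends :: "vertex list \<Rightarrow> vertex set" where
  "ends p = {hd p, last p}"

definition signed_charge :: "bool \<Rightarrow> vertex set \<Rightarrow> int" where
  "signed_charge c F = int (card {v \<in> F. red c v}) - int (card {v \<in> F. green c v})"

definition is_fault :: "bool \<Rightarrow> nat \<Rightarrow> nat \<Rightarrow> nat \<Rightarrow> vertex set \<Rightarrow> bool" where
  "is_fault c n M C F \<longleftrightarrow> F \<subseteq> cube n \<and> card F = M \<and> \<bar>signed_charge c F\<bar> = int C"

definition neutral_pair :: "vertex set \<Rightarrow> bool" where
  "neutral_pair e \<longleftrightarrow> (\<exists>u v. e = {u, v} \<and> even_vertex u \<noteq> even_vertex v)"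

definition charged_pair :: "vertex set \<Rightarrow> bool" where
  "charged_pair e \<longleftrightarrow> (\<exists>u v. e = {u, v} \<and> u \<noteq> v \<and> even_vertex u = even_vertex v)"

definition red_pair :: "bool \<Rightarrow> vertex set \<Rightarrow> bool" where
  "red_pair c e \<longleftrightarrow> charged_pair e \<and> (\<forall>v\<in>e. red c v)"

definition green_pair :: "bool \<Rightarrow> vertex set \<Rightarrow> bool" where
  "green_pair c e \<longleftrightarrow> charged_pair e \<and> (\<forall>v\<in>e. green c v)"

definition disjoint_pairs :: "vertex set set \<Rightarrow> bool" where
  "disjoint_pairs E \<longleftrightarrow> (\<forall>e\<in>E. card e = 2) \<and> pairwise disjnt E"

definition in_balance :: "bool \<Rightarrow> nat \<Rightarrow> vertex set \<Rightarrow> vertex set set \<Rightarrow> bool" where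
  "in_balance c n F E \<longleftrightarrow>
    \<Union>E \<subseteq> cube n - F \<and>
    signed_charge c F = int (card {e \<in> E. green_pair c e}) - int (card {e \<in> E. red_pair c e})"

text \<open>\<open>N\<close> is the number of neutral pairs and \<open>K\<close> (the paper's \<open>O\<close>) the number of charged pairs.\<close>

definition admissible :: "bool \<Rightarrow> nat \<Rightarrow> vertex set \<Rightarrow> nat \<Rightarrow> nat \<Rightarrow> vertex set set \<Rightarrow> bool" where
  "admissible c n F N K E \<longleftrightarrow>
    disjoint_pairs E \<and> in_balance c n F E \<and>
    card {e \<in> E. neutral_pair e} = N \<and> card {e \<in> E. charged_pair e} = K"

definition freely_prescribable :: "bool \<Rightarrow> nat \<Rightarrow> vertex set \<Rightarrow> nat \<Rightarrow> nat \<Rightarrow> bool" where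
  "freely_prescribable c n F N K \<longleftrightarrow>
    (\<exists>E. admissible c n F N K E) \<and>
    (\<forall>E. admissible c n F N K E \<longrightarrow> (\<exists>P. path_covering n F P \<and> ends ` P = E))"

text \<open>If all four parameters are \<open>0\<close>, then \<open>log 2 0 = 0\<close> in HOL; the condition on \<open>m\<close> is then
  vacuous, exactly as it is under the convention that this logarithm is \<open>-\<infinity>\<close>.\<close>

definition A_set :: "bool \<Rightarrow> nat \<Rightarrow> nat \<Rightarrow> nat \<Rightarrow> nat \<Rightarrow> nat set" where
  "A_set c M C N K =
    {m. real m \<ge> log 2 (real (M + C + 2 * N + 2 * K)) \<and>
        (\<forall>n\<ge>m. \<forall>F. is_fault c n M C F \<longrightarrow> freely_prescribable c n F N K)}"

text \<open>The number \<open>[M, C, N, K]\<close>; the value \<open>None\<close> means that it is undefined.\<close>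

definition bracket :: "bool \<Rightarrow> nat \<Rightarrow> nat \<Rightarrow> nat \<Rightarrow> nat \<Rightarrow> nat option" where
  "bracket c M C N K =
    (if A_set c M C N K = {} then None else Some (LEAST m. m \<in> A_set c M C N K))"

end

theory Submission
  imports Defs
begin

text \<open>
  All statements are proved by splitting the cube along a coordinate into two facets, covering each
  facet by paths and joining them across. Two standard facts support this: the cube has a Hamiltonian
  path between any two vertices of opposite parity (\<open>ham_laceable\<close>), and after the deletion of one
  vertex it has one between any two vertices of the other parity (\<open>ham_connected_minus_vertex\<close>).

  Let \<open>r\<^sub>1\<close>, \<open>g\<^sub>1\<close> be the deleted vertices and \<open>r\<close>, \<open>g\<close> the ends. If a coordinate separates \<open>r\<^sub>1\<close> from
  \<open>g\<^sub>1\<close>, each facet has one fault. If moreover the ends are in the same facet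
  (\<open>ham_connected_same_side\<close>) or each end is with the fault of the other colour
  (\<open>ham_connected_opposite_sides\<close>), the facts above yield the path without any induction hypothesis.
  The only bad situation is that each end is with the fault of its own colour, in every coordinate that
  separates the faults. But then \<open>r\<close> and \<open>r\<^sub>1\<close> differ in a coordinate that does not separate the faults.
  In that splitting one facet has no fault and contains \<open>r\<close>; the other one has both faults and is
  covered by the induction hypothesis (\<open>ham_connected_one_end_with_faults\<close>,
  \<open>ham_connected_no_end_with_faults\<close>), with ends that can be chosen freely enough to avoid the
  exceptional pairs of dimension three. This is \<open>laceable_minus_pair_step\<close>, valid from dimension three
  on.

  In dimension two the ends are adjacent and nothing else is left. In dimension three the facets are
  squares, which leave less choice; the exceptional pairs are exactly those for which no coordinate
  works (\<open>exceptional_if_no_separating_coordinate\<close>).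

  For the value of the bracket, dimension at least four gives \<open>4\<close> as a member of the set, and an
  exceptional pair is a genuine obstruction in dimension three: the cube without two antipodes is a
  hexagon, which has no Hamiltonian path between opposite vertices (\<open>no_ham_path_hexagon\<close>).
\<close>

section \<open>Adjacency, parity and the facets of the hypercube\<close>

text \<open>Inserting a fixed bit \<open>b\<close> at a fixed position \<open>i\<close> embeds \<open>cube n\<close> as the facet
  \<open>v ! i = b\<close> of \<open>cube (Suc n)\<close>; this replaces the usual choice of coordinates in which a cube
  splits into two copies of the next smaller one. For \<open>i > length v\<close>, a case that does not occur for
  coordinates, the bit is appended at the end.\<close>

fun insert_bit :: "nat \<Rightarrow> bool \<Rightarrow> vertex \<Rightarrow> vertex" where
  "insert_bit 0 b v = b # v"
| "insert_bit (Suc i) b [] = [b]"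
| "insert_bit (Suc i) b (a # v) = a # insert_bit i b v"

lemma adj_sym: "adj u v \<Longrightarrow> adj v u"
  by (auto simp: adj_def eq_commute)

text \<open>The recursive form of adjacency: it allows proofs by induction on the coordinates, which the
  counting definition does not.\<close>

lemma adj_Cons_Cons: "adj (a # u) (b # v) \<longleftrightarrow> (if a = b then adj u v else u = v)"
proof -
  have *: "{i. i < length (a # u) \<and> (a # u) ! i \<noteq> (b # v) ! i}
      = (if a = b then {} else {0}) \<union> Suc ` {i. i < length u \<and> u ! i \<noteq> v ! i}" (is "?L = ?R")
    by (auto simp: less_Suc_eq_0_disj split: if_splits)
  have "card ?L = (if a = b then 0 else 1) + card {i. i < length u \<and> u ! i \<noteq> v ! i}"
    unfolding * by (subst card_Un_disjoint) (auto simp: card_image)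
  then show ?thesis
    by (auto simp: adj_def list_eq_iff_nth_eq)
qed

lemma not_adj_Nil [simp]: "\<not> adj [] v" "\<not> adj u []"
  by (auto simp: adj_def)

lemma even_vertex_Cons [simp]: "even_vertex (a # v) \<longleftrightarrow> (even_vertex v \<longleftrightarrow> \<not> a)"
  by (auto simp: even_vertex_def)

lemma even_vertex_Nil [simp]: "even_vertex []"
  by (auto simp: even_vertex_def)

lemma adj_parity: "adj u v \<Longrightarrow> even_vertex u \<noteq> even_vertex v"
proof (induction u arbitrary: v)
  case (Cons a u)
  then show ?case by (cases v) (auto simp: adj_Cons_Cons split: if_splits)
qed simp

lemma even_vertex_insert_bit [simp]:
  "even_vertex (insert_bit i b v) \<longleftrightarrow> (even_vertex v \<longleftrightarrow> \<not> b)"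
  by (induction i b v rule: insert_bit.induct) auto

lemma length_insert_bit [simp]: "length (insert_bit i b v) = Suc (length v)"
  by (induction i b v rule: insert_bit.induct) auto

lemma insert_bit_inject [simp]:
  "length u = length v \<Longrightarrow> insert_bit i b u = insert_bit i b v \<longleftrightarrow> u = v"
proof (induction i arbitrary: u v)
  case (Suc i)
  then show ?case by (cases u; cases v) auto
qed auto

lemma insert_bit_nth [simp]: "i \<le> length v \<Longrightarrow> insert_bit i b v ! i = b"
  by (induction i b v rule: insert_bit.induct) auto

lemma adj_insert_bit [simp]:
  "length u = length v \<Longrightarrow> adj (insert_bit i b u) (insert_bit i b v) \<longleftrightarrow> adj u v"
proof (induction i arbitrary: u v)
  case (Suc i)
  then show ?case by (cases u; cases v) (auto simp: adj_Cons_Cons)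
qed (auto simp: adj_Cons_Cons)

lemma adj_across_insert_bit: "b \<noteq> b' \<Longrightarrow> adj (insert_bit i b v) (insert_bit i b' v)"
  by (induction i b v rule: insert_bit.induct) (auto simp: adj_Cons_Cons)

lemma ex_insert_bit: "v \<in> cube (Suc n) \<Longrightarrow> i \<le> n \<Longrightarrow> \<exists>w\<in>cube n. v = insert_bit i (v ! i) w"
proof (induction i arbitrary: v n)
  case 0
  then show ?case by (auto simp: cube_def length_Suc_conv)
next
  case (Suc i)
  then obtain m a v' where "n = Suc m" "v = a # v'" "v' \<in> cube (Suc m)"
    by (cases n; cases v) (auto simp: cube_def)
  with Suc obtain w where "w \<in> cube m" "v' = insert_bit i (v' ! i) w" by fastforce
  with \<open>v = _\<close> \<open>n = _\<close> show ?case by (intro bexI[of _ "a # w"]) (auto simp: cube_def)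
qed

lemma facet_cases:
  assumes "v \<in> cube (Suc n)" "i < Suc n" "v ! i = b"
  obtains w where "w \<in> cube n" "v = insert_bit i b w"
  using ex_insert_bit[OF assms(1), of i] assms(2,3) that by auto

lemma insert_bit_in_cube [simp]: "insert_bit i b v \<in> cube (Suc n) \<longleftrightarrow> v \<in> cube n"
  by (simp add: cube_def)

lemma cube_Suc_eq: "i \<le> n \<Longrightarrow> cube (Suc n) = insert_bit i b ` cube n \<union> insert_bit i (\<not> b) ` cube n"
proof (intro equalityI subsetI)
  fix v assume "i \<le> n" "v \<in> cube (Suc n)"
  then obtain w where "w \<in> cube n" "v = insert_bit i (v ! i) w" using ex_insert_bit by blast
  then show "v \<in> insert_bit i b ` cube n \<union> insert_bit i (\<not> b) ` cube n"
    by (cases "v ! i"; cases b) auto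
qed auto

lemma insert_bit_neq:
  assumes "b \<noteq> b'" "i \<le> length u" "i \<le> length v"
  shows "insert_bit i b u \<noteq> insert_bit i b' v"
proof
  assume "insert_bit i b u = insert_bit i b' v"
  then have "insert_bit i b u ! i = insert_bit i b' v ! i" by simp
  with assms show False by simp
qed

lemma facets_disjoint:
  assumes "i \<le> n" "A \<subseteq> cube n" "B \<subseteq> cube n" "b \<noteq> b'"
  shows "insert_bit i b ` A \<inter> insert_bit i b' ` B = {}"
  using assms insert_bit_neq[OF assms(4)] by (fastforce simp: cube_def)

lemma adj_insert_bit_diff:
  "length u = length v \<Longrightarrow> i \<le> length u \<Longrightarrow> b \<noteq> b' \<Longrightarrow> adj (insert_bit i b u) (insert_bit i b' v) \<Longrightarrow> u = v"
proof (induction i arbitrary: u v)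
  case (Suc i)
  then show ?case
    using insert_bit_neq[OF Suc.prems(3), of i "tl u" "tl v"]
    by (cases u; cases v) (auto simp: adj_Cons_Cons split: if_splits)
qed (auto simp: adj_Cons_Cons)

lemma inj_on_insert_bit: "inj_on (insert_bit i b) (cube n)"
  by (auto simp: inj_on_def cube_def)

lemma finite_cube [simp]: "finite (cube n)"
  using finite_lists_length_eq[of "UNIV :: bool set" n] by (simp add: cube_def)

lemma card_cube [simp]: "card (cube n) = 2 ^ n"
  using card_lists_length_eq[of "UNIV :: bool set" n] by (simp add: cube_def)

lemma card_parity_class: "card {v \<in> cube (Suc n). even_vertex v = e} = 2 ^ n"
proof (induction n arbitrary: e)
  case 0
  have "{v \<in> cube (Suc 0). even_vertex v = e} = {[\<not> e]}"
    by (auto simp: cube_def length_Suc_conv)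
  then show ?case by simp
next
  case (Suc n)
  let ?C = "\<lambda>e. {v \<in> cube (Suc n). even_vertex v = e}"
  have "{v \<in> cube (Suc (Suc n)). even_vertex v = e} = Cons False ` ?C e \<union> Cons True ` ?C (\<not> e)"
    by (auto simp: cube_def length_Suc_conv image_iff)
  also have "card \<dots> = card (?C e) + card (?C (\<not> e))"
    by (subst card_Un_disjoint) (auto simp: card_image)
  finally show ?case using Suc by simp
qed

text \<open>Auxiliary vertices are always chosen by counting: one half of the \<open>2 ^ n\<close> vertices has a given
  parity, so fewer than \<open>2 ^ (n - 1)\<close> forbidden vertices leave a choice.\<close>

lemma ex_vertex_of_parity:
  assumes "finite S" "card S < 2 ^ (n - 1)" "n \<ge> 1"
  obtains v where "v \<in> cube n" "even_vertex v = e" "v \<notin> S"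
proof -
  have "card {v \<in> cube n. even_vertex v = e} = 2 ^ (n - 1)"
    using card_parity_class[of "n - 1" e] assms(3) by simp
  then have "\<not> {v \<in> cube n. even_vertex v = e} \<subseteq> S"
    using card_mono[OF assms(1), of "{v \<in> cube n. even_vertex v = e}"] assms(2) by linarith
  then show thesis using that by auto
qed

lemma ex_coordinate_neq:
  assumes "u \<in> cube n" "v \<in> cube n" "u \<noteq> v"
  obtains i where "i < n" "u ! i \<noteq> v ! i"
  using assms by (auto simp: cube_def list_eq_iff_nth_eq)

section \<open>Joining, splitting and lifting Hamiltonian paths\<close>

definition ham_connected :: "vertex set \<Rightarrow> vertex \<Rightarrow> vertex \<Rightarrow> bool" where
  "ham_connected S u v \<longleftrightarrow>
     (\<exists>p. p \<noteq> [] \<and> distinct p \<and> set p = S \<and> successively adj p \<and> hd p = u \<and> last p = v)"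

lemma ham_connected_sym: "ham_connected S u v \<Longrightarrow> ham_connected S v u"
proof -
  assume "ham_connected S u v"
  then obtain p where "p \<noteq> []" "distinct p" "set p = S" "successively adj p" "hd p = u" "last p = v"
    by (auto simp: ham_connected_def)
  moreover have "successively adj (rev p)"
    using \<open>successively adj p\<close> by (auto intro: successively_mono adj_sym)
  ultimately show ?thesis
    unfolding ham_connected_def by (intro exI[of _ "rev p"]) (auto simp: hd_rev last_rev)
qed

lemma ham_connected_join:
  assumes "ham_connected S u v" "ham_connected T w z" "adj v w" "S \<inter> T = {}"
  shows "ham_connected (S \<union> T) u z"
proof -
  from assms obtain p q where "p \<noteq> []" "distinct p" "set p = S" "successively adj p" "hd p = u" "last p = v"
   "q \<noteq> []" "distinct q" "set q = T" "successively adj q" "hd q = w" "last q = z"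
    by (auto simp: ham_connected_def)
  with assms show ?thesis
    unfolding ham_connected_def by (intro exI[of _ "p @ q"]) (auto simp: successively_append_iff)
qed

lemma ham_connected_split:
  assumes "ham_connected S u v" "w \<in> S" "w \<noteq> u"
  obtains A B a where "S = A \<union> B" "A \<inter> B = {}" "ham_connected A u a" "ham_connected B w v" "adj a w"
proof -
  obtain p where p: "p \<noteq> []" "distinct p" "set p = S" "successively adj p" "hd p = u" "last p = v"
    using assms by (auto simp: ham_connected_def)
  then obtain xs ys where p_eq: "p = xs @ w # ys" using assms by (metis split_list)
  have "xs \<noteq> []" using p p_eq assms by auto
  show thesis
  proof
    show "S = set xs \<union> set (w # ys)" "set xs \<inter> set (w # ys) = {}" "adj (last xs) w"
      using p p_eq \<open>xs \<noteq> []\<close> by (auto simp: successively_append_iff)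
    show "ham_connected (set xs) u (last xs)"
      unfolding ham_connected_def using p p_eq \<open>xs \<noteq> []\<close>
      by (intro exI[of _ xs]) (auto simp: successively_append_iff)
    show "ham_connected (set (w # ys)) w v"
      unfolding ham_connected_def using p p_eq \<open>xs \<noteq> []\<close>
      by (intro exI[of _ "w # ys"]) (auto simp: successively_append_iff)
  qed
qed

lemma ham_connected_facet:
  assumes "ham_connected S u v" "S \<subseteq> cube n"
  shows "ham_connected (insert_bit i b ` S) (insert_bit i b u) (insert_bit i b v)"
proof -
  obtain p where p: "p \<noteq> []" "distinct p" "set p = S" "successively adj p" "hd p = u" "last p = v"
    using assms by (auto simp: ham_connected_def)
  have "inj_on (insert_bit i b) (set p)"
    using inj_on_insert_bit assms(2) p by (metis inj_on_subset)
  moreover have "successively adj (map (insert_bit i b) p)"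
    unfolding successively_map
  proof (rule successively_mono[OF p(4)])
    fix x y assume "x \<in> set p" "y \<in> set p" "adj x y"
    then show "adj (insert_bit i b x) (insert_bit i b y)"
      using adj_insert_bit[of x y i b] by (auto simp: adj_def)
  qed
  ultimately show ?thesis
    unfolding ham_connected_def using p
    by (intro exI[of _ "map (insert_bit i b) p"]) (auto simp: distinct_map hd_map last_map)
qed

lemma ham_connected_across:
  assumes "i \<le> n" "b \<noteq> b'" "S \<subseteq> cube n" "T \<subseteq> cube n" "ham_connected S u w" "ham_connected T w v"
  shows "ham_connected (insert_bit i b ` S \<union> insert_bit i b' ` T) (insert_bit i b u) (insert_bit i b' v)"
  by (rule ham_connected_join[OF ham_connected_facet[OF assms(5,3)] ham_connected_facet[OF assms(6,4)]
      adj_across_insert_bit[OF assms(2)] facets_disjoint[OF assms(1,3,4,2)]])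

text \<open>A path of one facet that is cut between \<open>x\<close> and \<open>y\<close> can be closed again through the other facet:
  the copies of \<open>x\<close> and \<open>y\<close> there need not be adjacent, they only have to be joined by a path. Since
  \<open>x\<close> and \<open>y\<close> are arbitrary, the two pieces may also come from a path that runs through them in another
  order or direction.\<close>

lemma ham_connected_detour:
  assumes "i \<le> n" "b \<noteq> b'" "A \<union> B \<subseteq> cube n" "A \<inter> B = {}" "T \<subseteq> cube n"
    "ham_connected A u x" "ham_connected T x y" "ham_connected B y v"
  shows "ham_connected (insert_bit i b ` (A \<union> B) \<union> insert_bit i b' ` T) (insert_bit i b u) (insert_bit i b v)"
proof -
  have sub: "A \<subseteq> cube n" "B \<subseteq> cube n" using assms(3) by auto
  have "insert_bit i b ` A \<inter> insert_bit i b ` B = {}"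
    using assms(4) inj_on_image_Int[OF inj_on_insert_bit[of i b n] sub] by simp
  moreover have "insert_bit i b' ` T \<inter> insert_bit i b ` B = {}"
    by (rule facets_disjoint[OF assms(1,5) sub(2) assms(2)[symmetric]])
  ultimately have "(insert_bit i b ` A \<union> insert_bit i b' ` T) \<inter> insert_bit i b ` B = {}"
    by blast
  from ham_connected_join[OF ham_connected_across[OF assms(1,2) sub(1) assms(5,6,7)]
      ham_connected_facet[OF assms(8) sub(2)] adj_across_insert_bit[OF assms(2)[symmetric]] this]
  have "ham_connected (insert_bit i b ` A \<union> insert_bit i b' ` T \<union> insert_bit i b ` B)
    (insert_bit i b u) (insert_bit i b v)" .
  then show ?thesis by (simp add: image_Un Un_ac)
qed

lemma insert_bit_image_Diff:
  "S \<subseteq> cube n \<Longrightarrow> insert_bit i b ` (cube n - S) = insert_bit i b ` cube n - insert_bit i b ` S"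
  by (rule inj_on_image_set_diff[OF inj_on_insert_bit[of i b n]]) auto

lemma cube_Suc_minus:
  assumes "i \<le> n" "S \<subseteq> cube n" "T \<subseteq> cube n" "b \<noteq> b'"
  shows "cube (Suc n) - (insert_bit i b ` S \<union> insert_bit i b' ` T) =
    insert_bit i b ` (cube n - S) \<union> insert_bit i b' ` (cube n - T)"
proof -
  have "b' = (\<not> b)" using assms by auto
  then have "cube (Suc n) = insert_bit i b ` cube n \<union> insert_bit i b' ` cube n"
    using cube_Suc_eq assms(1) by blast
  moreover have "insert_bit i b ` cube n \<inter> insert_bit i b' ` cube n = {}"
    using facets_disjoint[OF assms(1) order_refl order_refl assms(4)] .
  ultimately show ?thesis
    using assms(2,3) unfolding insert_bit_image_Diff[OF assms(2)] insert_bit_image_Diff[OF assms(3)]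
    by blast
qed

section \<open>Laceability with no fault and with one fault\<close>

text \<open>Splitting along a coordinate in which the ends differ puts them in different facets; any vertex
  \<open>w\<close> of the right parity can serve as the place where the path crosses.\<close>

theorem ham_laceable:
  assumes "n \<ge> 1" "u \<in> cube n" "v \<in> cube n" "even_vertex u \<noteq> even_vertex v"
  shows "ham_connected (cube n) u v"
  using assms
proof (induction n arbitrary: u v rule: dec_induct)
  case base
  then have "cube 1 = {u, v}" "adj u v" "u \<noteq> v"
    by (auto simp: cube_def length_Suc_conv adj_Cons_Cons)
  then show ?case
    unfolding ham_connected_def by (intro exI[of _ "[u, v]"]) auto
next
  case (step n)
  then have "u \<noteq> v" by auto
  then obtain i where i: "i < Suc n" "u ! i \<noteq> v ! i"
    using ex_coordinate_neq[of u "Suc n" v] step.prems by auto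
  define b b' where "b = u ! i" and "b' = v ! i"
  obtain u' where u': "u' \<in> cube n" "u = insert_bit i b u'"
    using facet_cases[OF step.prems(1) i(1) b_def[symmetric]] .
  obtain v' where v': "v' \<in> cube n" "v = insert_bit i b' v'"
    using facet_cases[OF step.prems(2) i(1) b'_def[symmetric]] .
  have b: "b \<noteq> b'" using i b_def b'_def by auto
  obtain w where w: "w \<in> cube n" "even_vertex w = (\<not> even_vertex u')"
    using ex_vertex_of_parity[of "{}" n "\<not> even_vertex u'"] step by auto
  have "ham_connected (cube n) u' w" "ham_connected (cube n) w v'"
    using step.IH step.prems(3) w u' v' b by auto
  then show ?case
    using ham_connected_across[of i n b b' "cube n" "cube n" u' w v']
      cube_Suc_minus[of i n "{}" "{}" b b'] i b u' v' by simp
qed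

text \<open>After the deletion the parity class without \<open>x\<close> has one vertex more than the other, so an
  alternating path that covers everything must begin and end in it. Again the ends are separated by a coordinate, and only the facet of \<open>x\<close> uses the induction
  hypothesis; the other one is laceable. The exception \<open>n = 1\<close> is the path with a single vertex; it
  makes the induction start without a separate treatment of the square.\<close>

theorem ham_connected_minus_vertex:
  assumes "n \<ge> 1" "x \<in> cube n" "u \<in> cube n" "v \<in> cube n"
    "even_vertex u \<noteq> even_vertex x" "even_vertex v \<noteq> even_vertex x" "u \<noteq> v \<or> n = 1"
  shows "ham_connected (cube n - {x}) u v"
  using assms
proof (induction n arbitrary: x u v rule: dec_induct)
  case base
  then have "cube 1 - {x} = {u}" "u = v"
    by (auto simp: cube_def length_Suc_conv)
  then show ?case
    unfolding ham_connected_def by (intro exI[of _ "[u]"]) auto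
next
  case (step n)
  have *: "ham_connected (cube (Suc n) - {x}) u v"
    if i: "i < Suc n" "u ! i \<noteq> v ! i" "x ! i = u ! i" and uvx: "u \<in> cube (Suc n)"
      "v \<in> cube (Suc n)" "x \<in> cube (Suc n)" "even_vertex u \<noteq> even_vertex x" "even_vertex v \<noteq> even_vertex x"
    for u v i
  proof -
    define b b' where "b = u ! i" and "b' = v ! i"
    have b: "b \<noteq> b'" using i b_def b'_def by auto
    obtain u' where u': "u' \<in> cube n" "u = insert_bit i b u'"
      using facet_cases[OF uvx(1) i(1) b_def[symmetric]] .
    obtain v' where v': "v' \<in> cube n" "v = insert_bit i b' v'"
      using facet_cases[OF uvx(2) i(1) b'_def[symmetric]] .
    obtain x' where x': "x' \<in> cube n" "x = insert_bit i b x'"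
      using facet_cases[OF uvx(3) i(1) i(3)[folded b_def]] .
    have par: "even_vertex u' \<noteq> even_vertex x'" "even_vertex v' = even_vertex x'"
      using uvx(4,5) b u' v' x' by auto
    obtain w where w: "w \<in> cube n" "even_vertex w = even_vertex u'" "u' \<noteq> w \<or> n = 1"
    proof (cases "n = 1")
      case False
      then have "card {u'} < 2 ^ (n - 1)" using step.hyps one_less_power[of "2 :: nat" "n - 1"] by simp
      then show thesis
        using ex_vertex_of_parity[of "{u'}" n "even_vertex u'"] step.hyps that by auto
    qed (use u' in auto)
    have "ham_connected (cube n - {x'}) u' w" "ham_connected (cube n) w v'"
      using step.IH ham_laceable u' v' x' w par step.hyps by auto
    then show ?thesis
      using ham_connected_across[of i n b b' "cube n - {x'}" "cube n" u' w v']
        cube_Suc_minus[of i n "{x'}" "{}" b b'] i b u' v' x' by simp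
  qed
  have "u \<noteq> v" using step by auto
  then obtain i where i: "i < Suc n" "u ! i \<noteq> v ! i"
    using ex_coordinate_neq[of u "Suc n" v] step.prems by auto
  show ?case
  proof (cases "x ! i = u ! i")
    case True
    then show ?thesis using * i step.prems by blast
  next
    case False
    then have "x ! i = v ! i" using i by auto
    then show ?thesis using *[of i v u] i step.prems ham_connected_sym by metis
  qed
qed

lemma cube_3_cases:
  assumes "v \<in> cube 3"
  obtains a b c where "v = [a, b, c]"
  using assms by (auto simp: cube_def numeral_3_eq_3 length_Suc_conv)

lemma adj_cube_3:
  "adj [a, b, c] [d, e, f] \<longleftrightarrow> (a \<noteq> d \<and> b = e \<and> c = f) \<or> (a = d \<and> b \<noteq> e \<and> c = f) \<or> (a = d \<and> b = e \<and> c \<noteq> f)"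
  by (auto simp: adj_Cons_Cons)

lemma not_adj_antipode: "v \<in> cube 3 \<Longrightarrow> \<not> adj (antipode v) v"
  by (auto simp: cube_def antipode_def adj_Cons_Cons numeral_3_eq_3 length_Suc_conv)

section \<open>Splittings according to the position of ends and faults\<close>

text \<open>The faults lie in different facets and both ends in the facet of \<open>r\<^sub>1\<close>. Without \<open>r\<^sub>1\<close> that facet has
  a Hamiltonian path from \<open>g\<close> to another vertex \<open>w\<close> of the colour of \<open>g\<close>. It meets \<open>r\<close> at an inner
  point; let \<open>a\<close> be the vertex before \<open>r\<close>. The pieces \<open>r, \<dots>, w\<close> and \<open>a, \<dots>, g\<close> are then joined
  through the other facet by a path from the copy of \<open>w\<close> to the copy of \<open>a\<close>; both copies have the
  parity opposite to that of the fault \<open>g\<^sub>1\<close>, so one fault can be tolerated there.\<close>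

lemma ham_connected_same_side:
  assumes "n \<ge> 2" "i < Suc n" "{r, r\<^sub>1, g, g\<^sub>1} \<subseteq> cube (Suc n)"
    "even_vertex r\<^sub>1 = even_vertex r" "even_vertex g \<noteq> even_vertex r" "even_vertex g\<^sub>1 \<noteq> even_vertex r"
    "r \<noteq> r\<^sub>1" "r\<^sub>1 ! i \<noteq> g\<^sub>1 ! i" "r ! i = r\<^sub>1 ! i" "g ! i = r\<^sub>1 ! i"
  shows "ham_connected (cube (Suc n) - {r\<^sub>1, g\<^sub>1}) r g"
proof -
  define b b' where "b = r\<^sub>1 ! i" and "b' = g\<^sub>1 ! i"
  have b: "b \<noteq> b'" and bits: "r ! i = b" "g ! i = b" "r\<^sub>1 ! i = b" "g\<^sub>1 ! i = b'"
    using assms(8-10) unfolding b_def b'_def by blast+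
  have verts: "r \<in> cube (Suc n)" "g \<in> cube (Suc n)" "r\<^sub>1 \<in> cube (Suc n)" "g\<^sub>1 \<in> cube (Suc n)"
    using assms(3) by simp_all
  obtain r' where r': "r' \<in> cube n" "r = insert_bit i b r'"
    using facet_cases[OF verts(1) assms(2) bits(1)] .
  obtain g' where g': "g' \<in> cube n" "g = insert_bit i b g'"
    using facet_cases[OF verts(2) assms(2) bits(2)] .
  obtain r1' where r1': "r1' \<in> cube n" "r\<^sub>1 = insert_bit i b r1'"
    using facet_cases[OF verts(3) assms(2) bits(3)] .
  obtain g1' where g1': "g1' \<in> cube n" "g\<^sub>1 = insert_bit i b' g1'"
    using facet_cases[OF verts(4) assms(2) bits(4)] .
  have par: "even_vertex r1' = even_vertex r'" "even_vertex g' \<noteq> even_vertex r'" "even_vertex g1' = even_vertex r'"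
    using assms(4-6) b r' g' r1' g1' by auto
  have "card {g'} < 2 ^ (n - 1)"
    using assms(1) one_less_power[of "2 :: nat" "n - 1"] by simp
  then obtain w where w: "w \<in> cube n" "even_vertex w = even_vertex g'" "w \<noteq> g'"
    using ex_vertex_of_parity[of "{g'}" n "even_vertex g'"] assms(1) by auto
  have "ham_connected (cube n - {r1'}) g' w"
    using ham_connected_minus_vertex[of n r1' g' w] assms(1) g' r1' w par by auto
  moreover have "r' \<in> cube n - {r1'}" "r' \<noteq> g'"
    using assms(7) r' r1' par by auto
  ultimately obtain A B a where AB: "cube n - {r1'} = A \<union> B" "A \<inter> B = {}"
    "ham_connected A g' a" "ham_connected B r' w" "adj a r'"
    by (rule ham_connected_split)
  have "a \<in> A" "w \<in> B" using AB unfolding ham_connected_def by (auto dest: last_in_set)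
  then have a: "a \<in> cube n" "a \<noteq> w" "even_vertex a \<noteq> even_vertex r'"
    using AB adj_parity by blast+
  have "ham_connected (cube n - {g1'}) w a"
    using ham_connected_minus_vertex[of n g1' w a] assms(1) g1' w a par by auto
  from ham_connected_detour[OF _ b _ _ _ AB(4) this ham_connected_sym[OF AB(3)], of i n]
  have "ham_connected (insert_bit i b ` (cube n - {r1'}) \<union> insert_bit i b' ` (cube n - {g1'})) r g"
    unfolding Un_commute[of B A] AB(1)[symmetric] r'(2) g'(2)
    using assms(2) AB(2) by (simp add: Int_commute)
  then show ?thesis
    using cube_Suc_minus[of i n "{r1'}" "{g1'}" b b'] b assms(2) r1' g1' by (simp add: insert_commute)
qed

text \<open>One facet contains \<open>r\<close> and \<open>g\<^sub>1\<close>, the other one \<open>g\<close> and \<open>r\<^sub>1\<close>. In each facet a path between two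
  vertices of the colour that has lost nothing covers the rest, so it suffices to cross at a vertex \<open>a\<close>
  different from both ends. For \<open>n = 2\<close> there is no such \<open>a\<close> unless the two ends have the same position
  in their facets, that is, unless they are adjacent.\<close>

lemma ham_connected_opposite_sides:
  assumes "n \<ge> 2" "i < Suc n" "{r, r\<^sub>1, g, g\<^sub>1} \<subseteq> cube (Suc n)"
    "even_vertex r\<^sub>1 = even_vertex r" "even_vertex g \<noteq> even_vertex r" "even_vertex g\<^sub>1 \<noteq> even_vertex r"
    "r\<^sub>1 ! i \<noteq> g\<^sub>1 ! i" "r ! i = g\<^sub>1 ! i" "g ! i = r\<^sub>1 ! i" "n \<ge> 3 \<or> adj r g"
  shows "ham_connected (cube (Suc n) - {r\<^sub>1, g\<^sub>1}) r g"
proof -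
  define b b' where "b = g\<^sub>1 ! i" and "b' = r\<^sub>1 ! i"
  have b: "b \<noteq> b'" and bits: "r ! i = b" "g ! i = b'" "r\<^sub>1 ! i = b'" "g\<^sub>1 ! i = b"
    using assms(7-9) unfolding b_def b'_def by blast+
  have verts: "r \<in> cube (Suc n)" "g \<in> cube (Suc n)" "r\<^sub>1 \<in> cube (Suc n)" "g\<^sub>1 \<in> cube (Suc n)"
    using assms(3) by simp_all
  obtain r' where r': "r' \<in> cube n" "r = insert_bit i b r'"
    using facet_cases[OF verts(1) assms(2) bits(1)] .
  obtain g' where g': "g' \<in> cube n" "g = insert_bit i b' g'"
    using facet_cases[OF verts(2) assms(2) bits(2)] .
  obtain r1' where r1': "r1' \<in> cube n" "r\<^sub>1 = insert_bit i b' r1'"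
    using facet_cases[OF verts(3) assms(2) bits(3)] .
  obtain g1' where g1': "g1' \<in> cube n" "g\<^sub>1 = insert_bit i b g1'"
    using facet_cases[OF verts(4) assms(2) bits(4)] .
  have par: "even_vertex r1' \<noteq> even_vertex r'" "even_vertex g' = even_vertex r'" "even_vertex g1' \<noteq> even_vertex r'"
    using assms(4-6) b r' g' r1' g1' by auto
  have "card {r', g'} < 2 ^ (n - 1)"
  proof (cases "n \<ge> 3")
    case True
    then have "(2 :: nat) ^ 2 \<le> 2 ^ (n - 1)" by (intro power_increasing) auto
    then show ?thesis using card_insert_le_m1[of 2 "{g'}" r'] by simp
  next
    case False
    then have "r' = g'" using adj_insert_bit_diff[of r' g' i b b'] b assms(2,10) r' g' by (auto simp: cube_def)
    then show ?thesis using assms(1) one_less_power[of "2 :: nat" "n - 1"] by simp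
  qed
  then obtain a where a: "a \<in> cube n" "even_vertex a = even_vertex r'" "a \<noteq> r'" "a \<noteq> g'"
    using ex_vertex_of_parity[of "{r', g'}" n "even_vertex r'"] assms(1) by auto
  have "ham_connected (cube n - {g1'}) r' a" "ham_connected (cube n - {r1'}) a g'"
    using ham_connected_minus_vertex[of n g1' r' a] ham_connected_minus_vertex[of n r1' a g']
      assms(1) r' g' r1' g1' a par by auto
  then show ?thesis
    using ham_connected_across[of i n b b' "cube n - {g1'}" "cube n - {r1'}" r' a g']
      cube_Suc_minus[of i n "{g1'}" "{r1'}" b b'] b assms(2) r' g' r1' g1' by (simp add: insert_commute)
qed

text \<open>The pairs that have to be excluded in the three-dimensional cube, with the pair \<open>(r, g)\<close> ordered
  by colour. Antipodes in that cube have opposite parities, hence the crossed equations in the second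
  case.\<close>

definition exceptional :: "nat \<Rightarrow> vertex \<Rightarrow> vertex \<Rightarrow> vertex \<Rightarrow> vertex \<Rightarrow> bool" where
  "exceptional n r\<^sub>1 g\<^sub>1 r g \<longleftrightarrow> n = 3 \<and>
     (if r\<^sub>1 = antipode g\<^sub>1 then r = antipode g else r = antipode g\<^sub>1 \<and> g = antipode r\<^sub>1)"

text \<open>The induction invariant. It is symmetric in the two colours, so that the roles of \<open>(r, r\<^sub>1)\<close> and
  \<open>(g, g\<^sub>1)\<close> can be exchanged.\<close>

definition laceable_minus_pair :: "nat \<Rightarrow> bool" where
  "laceable_minus_pair n \<longleftrightarrow> (\<forall>r r\<^sub>1 g g\<^sub>1. {r, r\<^sub>1, g, g\<^sub>1} \<subseteq> cube n \<longrightarrow> r \<noteq> r\<^sub>1 \<longrightarrow> g \<noteq> g\<^sub>1 \<longrightarrow>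
     even_vertex r\<^sub>1 = even_vertex r \<longrightarrow> even_vertex g \<noteq> even_vertex r \<longrightarrow> even_vertex g\<^sub>1 \<noteq> even_vertex r \<longrightarrow>
     \<not> exceptional n r\<^sub>1 g\<^sub>1 r g \<longrightarrow> ham_connected (cube n - {r\<^sub>1, g\<^sub>1}) r g)"

text \<open>The facet of the faults contains \<open>g\<close> only. The other facet is fault-free and hence traversed from
  \<open>r\<close> to any vertex \<open>a\<close> of the right parity; the rest is an instance of the smaller problem with ends
  \<open>a\<close> and \<open>g\<close>. In dimension three an exceptional \<open>a\<close> is the antipode of \<open>g\<close> or of \<open>g\<^sub>1\<close>, so at most
  three of the four candidates are forbidden.\<close>

lemma ham_connected_one_end_with_faults:
  assumes "laceable_minus_pair n" "n \<ge> 2" "i < Suc n" "{r, r\<^sub>1, g, g\<^sub>1} \<subseteq> cube (Suc n)" "g \<noteq> g\<^sub>1"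
    "even_vertex r\<^sub>1 = even_vertex r" "even_vertex g \<noteq> even_vertex r" "even_vertex g\<^sub>1 \<noteq> even_vertex r"
    "r\<^sub>1 ! i = g\<^sub>1 ! i" "g ! i = g\<^sub>1 ! i" "r ! i \<noteq> g\<^sub>1 ! i"
  shows "ham_connected (cube (Suc n) - {r\<^sub>1, g\<^sub>1}) r g"
proof -
  define b b' where "b = r ! i" and "b' = g ! i"
  have b: "b \<noteq> b'" and bits: "r ! i = b" "g ! i = b'" "r\<^sub>1 ! i = b'" "g\<^sub>1 ! i = b'"
    using assms(9-11) unfolding b_def b'_def by blast+
  have verts: "r \<in> cube (Suc n)" "g \<in> cube (Suc n)" "r\<^sub>1 \<in> cube (Suc n)" "g\<^sub>1 \<in> cube (Suc n)"
    using assms(4) by simp_all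
  obtain r' where r': "r' \<in> cube n" "r = insert_bit i b r'"
    using facet_cases[OF verts(1) assms(3) bits(1)] .
  obtain g' where g': "g' \<in> cube n" "g = insert_bit i b' g'"
    using facet_cases[OF verts(2) assms(3) bits(2)] .
  obtain r1' where r1': "r1' \<in> cube n" "r\<^sub>1 = insert_bit i b' r1'"
    using facet_cases[OF verts(3) assms(3) bits(3)] .
  obtain g1' where g1': "g1' \<in> cube n" "g\<^sub>1 = insert_bit i b' g1'"
    using facet_cases[OF verts(4) assms(3) bits(4)] .
  have par: "even_vertex r1' \<noteq> even_vertex r'" "even_vertex g' = even_vertex r'" "even_vertex g1' = even_vertex r'"
    "g' \<noteq> g1'"
    using assms(5-8) b r' g' r1' g1' by auto
  obtain a where a: "a \<in> cube n" "even_vertex a = even_vertex r1'" "a \<noteq> r1'"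
    and ok: "\<not> exceptional n r1' g1' a g'"
  proof (cases "n = 2")
    case True
    then show thesis
      using ex_vertex_of_parity[of "{r1'}" n "even_vertex r1'"] that by (force simp: exceptional_def)
  next
    case False
    then have "(2 :: nat) ^ 2 \<le> 2 ^ (n - 1)" using assms(2) by (intro power_increasing) auto
    moreover have "card {r1', antipode g', antipode g1'} \<le> 3"
      by (simp add: card_insert_if)
    ultimately have "card {r1', antipode g', antipode g1'} < 2 ^ (n - 1)" by simp
    then obtain a where "a \<in> cube n" "even_vertex a = even_vertex r1'"
      and a: "a \<notin> {r1', antipode g', antipode g1'}"
      using ex_vertex_of_parity[of "{r1', antipode g', antipode g1'}" n "even_vertex r1'"] assms(2)
      by auto
    moreover have "\<not> exceptional n r1' g1' a g'"
      unfolding exceptional_def using a by (metis insertCI)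
    ultimately show thesis using that by simp
  qed
  have "ham_connected (cube n) r' a"
    using ham_laceable[of n r' a] assms(2) r' a par by auto
  moreover have "ham_connected (cube n - {r1', g1'}) a g'"
  proof -
    have "{a, r1', g', g1'} \<subseteq> cube n" "even_vertex r1' = even_vertex a"
      "even_vertex g' \<noteq> even_vertex a" "even_vertex g1' \<noteq> even_vertex a"
      using a r1' g' g1' par by simp_all
    then show ?thesis
      using assms(1) a(3) par(4) ok unfolding laceable_minus_pair_def by blast
  qed
  ultimately show ?thesis
    using ham_connected_across[of i n b b' "cube n" "cube n - {r1', g1'}" r' a g']
      cube_Suc_minus[of i n "{}" "{r1', g1'}" b b'] b assms(3) r' g' r1' g1' by simp
qed

text \<open>Among \<open>card T + 1\<close> disjoint edges of the path one avoids \<open>T\<close>.\<close>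

lemma ex_consecutive_pair_avoiding:
  assumes "distinct p" "finite T" "length p \<ge> 2 * card T + 2"
  shows "\<exists>xs x y ys. p = xs @ x # y # ys \<and> x \<notin> T \<and> y \<notin> T"
  using assms
proof (induction p arbitrary: T rule: induct_list012)
  case (3 x y p)
  show ?case
  proof (cases "x \<in> T \<or> y \<in> T")
    case False
    then show ?thesis by (intro exI[of _ "[]"] exI[of _ x] exI[of _ y] exI[of _ p]) simp
  next
    case True
    then have "card (T - {x, y}) < card T"
      using 3(4) by (intro psubset_card_mono) auto
    then have "2 * card (T - {x, y}) + 2 \<le> length p" using 3(5) by simp
    then have "\<exists>xs x' y' ys. p = xs @ x' # y' # ys \<and> x' \<notin> T - {x, y} \<and> y' \<notin> T - {x, y}"
      by (intro "3.IH"(1)) (use 3(3,4) in simp_all)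
    then obtain xs x' y' ys where *: "p = xs @ x' # y' # ys" "x' \<notin> T - {x, y}" "y' \<notin> T - {x, y}"
      by blast
    moreover have "x' \<notin> {x, y}" "y' \<notin> {x, y}" using 3(3) *(1) by auto
    ultimately have "x # y # p = (x # y # xs) @ x' # y' # ys \<and> x' \<notin> T \<and> y' \<notin> T"
      by simp
    then show ?thesis by blast
  qed
qed simp_all

lemma ham_connected_split_avoiding:
  assumes "ham_connected S u v" "finite T" "card S \<ge> 2 * card T + 2"
  obtains A B x y where "S = A \<union> B" "A \<inter> B = {}" "ham_connected A u x" "ham_connected B y v"
    "adj x y" "x \<in> S - T" "y \<in> S - T"
proof -
  obtain p where p: "p \<noteq> []" "distinct p" "set p = S" "successively adj p" "hd p = u" "last p = v"
    using assms by (auto simp: ham_connected_def)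
  then have "length p \<ge> 2 * card T + 2" using assms(3) distinct_card by metis
  then obtain xs x y ys where p_eq: "p = xs @ x # y # ys" and T: "x \<notin> T" "y \<notin> T"
    using ex_consecutive_pair_avoiding[OF p(2) assms(2)] by blast
  show thesis
  proof
    show "S = set (xs @ [x]) \<union> set (y # ys)" "set (xs @ [x]) \<inter> set (y # ys) = {}" "adj x y"
      "x \<in> S - T" "y \<in> S - T"
      using p p_eq T by (auto simp: successively_append_iff)
    show "ham_connected (set (xs @ [x])) u x"
      unfolding ham_connected_def using p p_eq
      by (intro exI[of _ "xs @ [x]"]) (auto simp: successively_append_iff hd_append split: if_splits)
    show "ham_connected (set (y # ys)) y v"
      unfolding ham_connected_def using p p_eq
      by (intro exI[of _ "y # ys"]) (auto simp: successively_append_iff)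
  qed
qed

text \<open>Both ends lie in the fault-free facet. A Hamiltonian path of that facet is opened at an edge \<open>x y\<close>
  and closed by a detour through the facet of the faults, which is an instance of the smaller problem
  with adjacent ends. The edge has to avoid the positions of the two faults; avoiding also the antipode
  of \<open>r\<^sub>1\<close> excludes the exceptional pairs of dimension three, since a pair of antipodes is never an
  edge. Eight vertices suffice for avoiding three.\<close>

lemma ham_connected_no_end_with_faults:
  assumes "laceable_minus_pair n" "n \<ge> 3" "i < Suc n" "{r, r\<^sub>1, g, g\<^sub>1} \<subseteq> cube (Suc n)"
    "even_vertex r\<^sub>1 = even_vertex r" "even_vertex g \<noteq> even_vertex r" "even_vertex g\<^sub>1 \<noteq> even_vertex r"
    "r\<^sub>1 ! i = g\<^sub>1 ! i" "g ! i = r ! i" "r ! i \<noteq> g\<^sub>1 ! i"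
  shows "ham_connected (cube (Suc n) - {r\<^sub>1, g\<^sub>1}) r g"
proof -
  define b b' where "b = r ! i" and "b' = g\<^sub>1 ! i"
  have b: "b \<noteq> b'" and bits: "r ! i = b" "g ! i = b" "r\<^sub>1 ! i = b'" "g\<^sub>1 ! i = b'"
    using assms(8-10) unfolding b_def b'_def by blast+
  have verts: "r \<in> cube (Suc n)" "g \<in> cube (Suc n)" "r\<^sub>1 \<in> cube (Suc n)" "g\<^sub>1 \<in> cube (Suc n)"
    using assms(4) by simp_all
  obtain r' where r': "r' \<in> cube n" "r = insert_bit i b r'"
    using facet_cases[OF verts(1) assms(3) bits(1)] .
  obtain g' where g': "g' \<in> cube n" "g = insert_bit i b g'"
    using facet_cases[OF verts(2) assms(3) bits(2)] .
  obtain r1' where r1': "r1' \<in> cube n" "r\<^sub>1 = insert_bit i b' r1'"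
    using facet_cases[OF verts(3) assms(3) bits(3)] .
  obtain g1' where g1': "g1' \<in> cube n" "g\<^sub>1 = insert_bit i b' g1'"
    using facet_cases[OF verts(4) assms(3) bits(4)] .
  have par: "even_vertex r1' \<noteq> even_vertex r'" "even_vertex g' \<noteq> even_vertex r'" "even_vertex g1' = even_vertex r'"
    using assms(5-7) b r' g' r1' g1' by auto
  define T where "T = {r1', g1', antipode r1'}"
  have "(2 :: nat) ^ 3 \<le> 2 ^ n" using assms(2) by (intro power_increasing) auto
  moreover have "finite T" "card T \<le> 3" by (simp_all add: T_def card_insert_if)
  moreover have "ham_connected (cube n) r' g'"
    using ham_laceable[of n r' g'] assms(2) r' g' par by auto
  ultimately have "ham_connected (cube n) r' g'" "finite T" "card (cube n) \<ge> 2 * card T + 2"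
    by auto
  then obtain A B x y where AB: "cube n = A \<union> B" "A \<inter> B = {}" "ham_connected A r' x"
    "ham_connected B y g'" "adj x y" and xy: "x \<in> cube n - T" "y \<in> cube n - T"
    by (rule ham_connected_split_avoiding)
  have ok: "\<not> exceptional n r1' g1' u v" if "adj u v" "v \<in> cube n" "v \<notin> T" for u v
  proof
    assume "exceptional n r1' g1' u v"
    then have "n = 3" "u = antipode v \<or> v = antipode r1'"
      by (simp_all add: exceptional_def split: if_splits)
    with that not_adj_antipode[of v] show False by (auto simp: T_def)
  qed
  have ham: "ham_connected (cube n - {r1', g1'}) u v"
    if "adj u v" "u \<in> cube n - T" "v \<in> cube n - T" "even_vertex u = even_vertex r1'" for u v
  proof -
    have "{u, r1', v, g1'} \<subseteq> cube n" "u \<noteq> r1'" "v \<noteq> g1'" using that r1' g1' by (auto simp: T_def)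
    moreover have "even_vertex r1' = even_vertex u" "even_vertex v \<noteq> even_vertex u"
      "even_vertex g1' \<noteq> even_vertex u"
      using that(4) par adj_parity[OF that(1)] by simp_all
    ultimately show ?thesis
      using assms(1) ok[OF that(1)] that(3) unfolding laceable_minus_pair_def by blast
  qed
  have "ham_connected (cube n - {r1', g1'}) x y"
  proof (cases "even_vertex x = even_vertex r1'")
    case True
    then show ?thesis by (rule ham[OF AB(5) xy])
  next
    case False
    then have "even_vertex y = even_vertex r1'" using adj_parity[OF AB(5)] by simp
    then show ?thesis by (rule ham_connected_sym[OF ham[OF adj_sym[OF AB(5)] xy(2,1)]])
  qed
  from ham_connected_detour[OF _ b _ AB(2) _ AB(3) this AB(4), of i n]
  have "ham_connected (insert_bit i b ` cube n \<union> insert_bit i b' ` (cube n - {r1', g1'})) r g"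
    unfolding AB(1)[symmetric] r'(2) g'(2) using assms(3) by simp
  then show ?thesis
    using cube_Suc_minus[of i n "{}" "{r1', g1'}" b b'] b assms(3) r1' g1' by simp
qed

section \<open>Induction on the dimension\<close>

text \<open>Only two kinds of coordinates are needed. Either some coordinate separates the two faults and does
  not put each end with the fault of its own colour: then the results with one fault per facet apply.
  Or \<open>r\<close> agrees with \<open>r\<^sub>1\<close> wherever the faults differ; then a coordinate in which \<open>r\<close> and \<open>r\<^sub>1\<close>
  differ puts both faults in one facet and \<open>r\<close> in the other one. The exceptional pairs of dimension
  three therefore do not propagate to dimension four.\<close>

lemma laceable_minus_pair_step:
  assumes "laceable_minus_pair n" "n \<ge> 3"
  shows "laceable_minus_pair (Suc n)"
  unfolding laceable_minus_pair_def
proof (intro allI impI)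
  fix r r\<^sub>1 g g\<^sub>1
  assume V: "{r, r\<^sub>1, g, g\<^sub>1} \<subseteq> cube (Suc n)" and ne: "r \<noteq> r\<^sub>1" "g \<noteq> g\<^sub>1"
    and par: "even_vertex r\<^sub>1 = even_vertex r" "even_vertex g \<noteq> even_vertex r" "even_vertex g\<^sub>1 \<noteq> even_vertex r"
  have V': "{g, g\<^sub>1, r, r\<^sub>1} \<subseteq> cube (Suc n)" using V by auto
  show "ham_connected (cube (Suc n) - {r\<^sub>1, g\<^sub>1}) r g"
  proof (cases "\<exists>i<Suc n. r\<^sub>1 ! i \<noteq> g\<^sub>1 ! i \<and> \<not> (r ! i = r\<^sub>1 ! i \<and> g ! i = g\<^sub>1 ! i)")
    case True
    then obtain i where i: "i < Suc n" "r\<^sub>1 ! i \<noteq> g\<^sub>1 ! i" "\<not> (r ! i = r\<^sub>1 ! i \<and> g ! i = g\<^sub>1 ! i)"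
      by blast
    then consider "r ! i = r\<^sub>1 ! i" "g ! i = r\<^sub>1 ! i" | "r ! i = g\<^sub>1 ! i" "g ! i = g\<^sub>1 ! i"
      | "r ! i = g\<^sub>1 ! i" "g ! i = r\<^sub>1 ! i"
      by blast
    then show ?thesis
    proof cases
      case 1
      then show ?thesis using ham_connected_same_side[OF _ i(1) V] assms(2) i ne par by auto
    next
      case 2
      then have "ham_connected (cube (Suc n) - {g\<^sub>1, r\<^sub>1}) g r"
        using ham_connected_same_side[OF _ i(1) V'] assms(2) i ne par by auto
      then show ?thesis using ham_connected_sym by (simp add: insert_commute)
    next
      case 3
      then show ?thesis using ham_connected_opposite_sides[OF _ i(1) V] assms(2) i par by auto
    qed
  next
    case False
    obtain i where i: "i < Suc n" "r ! i \<noteq> r\<^sub>1 ! i"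
      using ex_coordinate_neq[of r "Suc n" r\<^sub>1] V ne by auto
    with False have eq: "r\<^sub>1 ! i = g\<^sub>1 ! i" by blast
    show ?thesis
    proof (cases "g ! i = g\<^sub>1 ! i")
      case True
      then show ?thesis
        using ham_connected_one_end_with_faults[OF assms(1) _ i(1) V ne(2)] assms(2) i eq par by auto
    next
      case False
      then show ?thesis
        using ham_connected_no_end_with_faults[OF assms i(1) V] i eq par by auto
    qed
  qed
qed

lemma laceable_minus_pair_2: "laceable_minus_pair 2"
  unfolding laceable_minus_pair_def
proof (intro allI impI)
  fix r r\<^sub>1 g g\<^sub>1
  assume V: "{r, r\<^sub>1, g, g\<^sub>1} \<subseteq> cube 2" and ne: "r \<noteq> r\<^sub>1" "g \<noteq> g\<^sub>1"
    and par: "even_vertex r\<^sub>1 = even_vertex r" "even_vertex g \<noteq> even_vertex r" "even_vertex g\<^sub>1 \<noteq> even_vertex r"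
  have ne': "r \<noteq> g" "r \<noteq> g\<^sub>1" "r\<^sub>1 \<noteq> g" "r\<^sub>1 \<noteq> g\<^sub>1" using par by auto
  have "card {r, r\<^sub>1, g, g\<^sub>1} = card (cube 2)" using ne ne' by simp
  then have "cube 2 = {r, r\<^sub>1, g, g\<^sub>1}" using V by (metis card_subset_eq finite_cube)
  moreover have "adj r g"
    using V par by (auto simp: cube_def numeral_2_eq_2 length_Suc_conv adj_Cons_Cons split: if_splits)
  ultimately show "ham_connected (cube 2 - {r\<^sub>1, g\<^sub>1}) r g"
    using ne ne' unfolding ham_connected_def by (intro exI[of _ "[r, g]"]) auto
qed

text \<open>In dimension three no separating coordinate is available only for the exceptional pairs. The first
  assumption makes the ends differ exactly where the faults differ, in one or in all three coordinates
  by parity. If in all three, both pairs are antipodal. If in one, the second assumption puts \<open>r\<close> on the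
  side of \<open>r\<^sub>1\<close>, so \<open>r\<close> differs from \<open>r\<^sub>1\<close> in the two other coordinates and is the antipode of \<open>g\<^sub>1\<close>.\<close>

lemma exceptional_if_no_separating_coordinate:
  assumes "{r, r\<^sub>1, g, g\<^sub>1} \<subseteq> cube 3" "r \<noteq> r\<^sub>1" "g \<noteq> g\<^sub>1"
    "even_vertex r\<^sub>1 = even_vertex r" "even_vertex g \<noteq> even_vertex r" "even_vertex g\<^sub>1 \<noteq> even_vertex r"
    and same: "\<forall>i<3. r\<^sub>1 ! i \<noteq> g\<^sub>1 ! i \<longleftrightarrow> r ! i \<noteq> g ! i"
    and opp: "\<forall>i<3. r\<^sub>1 ! i \<noteq> g\<^sub>1 ! i \<longrightarrow> r ! i = g\<^sub>1 ! i \<longrightarrow> \<not> adj r g"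
  shows "exceptional 3 r\<^sub>1 g\<^sub>1 r g"
proof -
  have verts: "r \<in> cube 3" "r\<^sub>1 \<in> cube 3" "g \<in> cube 3" "g\<^sub>1 \<in> cube 3"
    using assms(1) by simp_all
  obtain a b c where r: "r = [a, b, c]" using cube_3_cases[OF verts(1)] .
  obtain a1 b1 c1 where r1: "r\<^sub>1 = [a1, b1, c1]" using cube_3_cases[OF verts(2)] .
  obtain d e f where g: "g = [d, e, f]" using cube_3_cases[OF verts(3)] .
  obtain d1 e1 f1 where g1: "g\<^sub>1 = [d1, e1, f1]" using cube_3_cases[OF verts(4)] .
  have three: "(\<forall>i<3. P i) \<longleftrightarrow> P 0 \<and> P 1 \<and> P (2::nat)" for P
    by (auto simp: numeral_3_eq_3 numeral_2_eq_2 less_Suc_eq)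
  have bits: "a \<noteq> d \<longleftrightarrow> a1 \<noteq> d1" "b \<noteq> e \<longleftrightarrow> b1 \<noteq> e1" "c \<noteq> f \<longleftrightarrow> c1 \<noteq> f1"
    using same unfolding r r1 g g1 three by auto
  show ?thesis
    using assms(2-6) opp bits unfolding r r1 g g1 three exceptional_def
    by (simp add: antipode_def adj_cube_3) argo
qed

lemma laceable_minus_pair_3: "laceable_minus_pair 3"
  unfolding laceable_minus_pair_def
proof (intro allI impI)
  fix r r\<^sub>1 g g\<^sub>1
  assume V: "{r, r\<^sub>1, g, g\<^sub>1} \<subseteq> cube 3" and ne: "r \<noteq> r\<^sub>1" "g \<noteq> g\<^sub>1"
    and par: "even_vertex r\<^sub>1 = even_vertex r" "even_vertex g \<noteq> even_vertex r" "even_vertex g\<^sub>1 \<noteq> even_vertex r"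
    and "\<not> exceptional 3 r\<^sub>1 g\<^sub>1 r g"
  then obtain i where "i < 3" "\<not> (r\<^sub>1 ! i \<noteq> g\<^sub>1 ! i \<longleftrightarrow> r ! i \<noteq> g ! i) \<or>
      r\<^sub>1 ! i \<noteq> g\<^sub>1 ! i \<and> r ! i \<noteq> g ! i \<and> r ! i = g\<^sub>1 ! i \<and> adj r g"
    using exceptional_if_no_separating_coordinate[OF V ne par] by blast
  then consider "r\<^sub>1 ! i \<noteq> g\<^sub>1 ! i" "r ! i = r\<^sub>1 ! i" "g ! i = r\<^sub>1 ! i"
    | "r\<^sub>1 ! i \<noteq> g\<^sub>1 ! i" "r ! i = g\<^sub>1 ! i" "g ! i = g\<^sub>1 ! i"
    | "r\<^sub>1 ! i \<noteq> g\<^sub>1 ! i" "r ! i = g\<^sub>1 ! i" "g ! i = r\<^sub>1 ! i" "adj r g"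
    | "r\<^sub>1 ! i = g\<^sub>1 ! i" "g ! i = g\<^sub>1 ! i" "r ! i \<noteq> g\<^sub>1 ! i"
    | "r\<^sub>1 ! i = g\<^sub>1 ! i" "r ! i = r\<^sub>1 ! i" "g ! i \<noteq> r\<^sub>1 ! i"
    by blast
  moreover have i: "i < Suc 2" using \<open>i < 3\<close> by simp
  moreover have V3: "{r, r\<^sub>1, g, g\<^sub>1} \<subseteq> cube (Suc 2)" "{g, g\<^sub>1, r, r\<^sub>1} \<subseteq> cube (Suc 2)"
    using V by simp_all
  ultimately show "ham_connected (cube 3 - {r\<^sub>1, g\<^sub>1}) r g"
  proof cases
    case 1
    then show ?thesis using ham_connected_same_side[OF _ i V3(1)] ne par by auto
  next
    case 2
    then have "ham_connected (cube 3 - {g\<^sub>1, r\<^sub>1}) g r"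
      using ham_connected_same_side[OF _ i V3(2)] ne par by auto
    then show ?thesis using ham_connected_sym by (simp add: insert_commute)
  next
    case 3
    then show ?thesis using ham_connected_opposite_sides[OF _ i V3(1)] par by auto
  next
    case 4
    then show ?thesis
      using ham_connected_one_end_with_faults[OF laceable_minus_pair_2 _ i V3(1) ne(2)] par by auto
  next
    case 5
    then have "ham_connected (cube 3 - {g\<^sub>1, r\<^sub>1}) g r"
      using ham_connected_one_end_with_faults[OF laceable_minus_pair_2 _ i V3(2) ne(1)] par by auto
    then show ?thesis using ham_connected_sym by (simp add: insert_commute)
  qed
qed

theorem laceable_minus_pair:
  assumes "n \<ge> 2"
  shows "laceable_minus_pair n"
proof (cases "n = 2")
  case False
  then have "n \<ge> 3" using assms by simp
  then show ?thesis
    by (induction n rule: dec_induct) (use laceable_minus_pair_3 laceable_minus_pair_step in auto)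
qed (simp add: laceable_minus_pair_2)

section \<open>Coloured pairs and path coverings\<close>

lemma hamiltonian_path_iff: "(\<exists>p. hamiltonian_path n F u v p) \<longleftrightarrow> ham_connected (cube n - F) u v"
  unfolding hamiltonian_path_def is_path_def ham_connected_def by (rule ex_cong1) auto

lemma exceptional_imp_bad_pairs:
  assumes "exceptional n r\<^sub>1 g\<^sub>1 r g" "{r, r\<^sub>1, g, g\<^sub>1} \<subseteq> cube n" "r \<noteq> r\<^sub>1"
    "red c r" "red c r\<^sub>1" "green c g" "green c g\<^sub>1"
  shows "{r, g} \<in> bad_pairs c r\<^sub>1 g\<^sub>1"
proof (cases "r\<^sub>1 = antipode g\<^sub>1")
  case True
  have "n = 3" "r = antipode g"
    using assms(1) unfolding exceptional_def if_P[OF True] by blast+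
  moreover have "r \<noteq> g\<^sub>1" using assms(4,7) unfolding green_def by blast
  then have "{r, g} \<noteq> {r\<^sub>1, g\<^sub>1}" using assms(3) by blast
  ultimately show ?thesis
    using assms(2,4,6) unfolding bad_pairs_def if_P[OF True] by blast
next
  case False
  have "r = antipode g\<^sub>1" "g = antipode r\<^sub>1"
    using assms(1) unfolding exceptional_def if_not_P[OF False] by blast+
  then show ?thesis unfolding bad_pairs_def if_not_P[OF False] by blast
qed

lemma ham_connected_minus_red_green_pair:
  assumes "n \<ge> 2" "{r, r\<^sub>1, g, g\<^sub>1} \<subseteq> cube n" "r \<noteq> r\<^sub>1" "g \<noteq> g\<^sub>1"
    "red c r" "red c r\<^sub>1" "green c g" "green c g\<^sub>1" "\<not> exceptional n r\<^sub>1 g\<^sub>1 r g"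
  shows "ham_connected (cube n - {r\<^sub>1, g\<^sub>1}) r g"
proof -
  have "even_vertex r\<^sub>1 = even_vertex r" "even_vertex g \<noteq> even_vertex r" "even_vertex g\<^sub>1 \<noteq> even_vertex r"
    using assms(5-8) by (auto simp: red_def green_def)
  then show ?thesis
    using laceable_minus_pair[OF assms(1)] assms(2-4,9) unfolding laceable_minus_pair_def by blast
qed

lemma finite_admissible:
  assumes "admissible c n F N K E"
  shows "finite E" "\<Union>E \<subseteq> cube n - F"
proof -
  show *: "\<Union>E \<subseteq> cube n - F" using assms by (auto simp: admissible_def in_balance_def)
  then have "E \<subseteq> Pow (cube n)" by blast
  then show "finite E" by (rule finite_subset) simp
qed

lemma charged_pair_doubleton: "charged_pair {u, v} \<longleftrightarrow> u \<noteq> v \<and> even_vertex u = even_vertex v"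
  by (auto simp: charged_pair_def doubleton_eq_iff)

lemma neutral_pair_doubleton: "neutral_pair {u, v} \<longleftrightarrow> even_vertex u \<noteq> even_vertex v"
  by (auto simp: neutral_pair_def doubleton_eq_iff)

lemma red_green_doubleton:
  assumes "even_vertex u \<noteq> even_vertex v"
  obtains r g where "{u, v} = {r, g}" "red c r" "green c g"
proof (cases "red c u")
  case True
  then have "green c v" using assms by (auto simp: red_def green_def)
  with True show thesis using that by blast
next
  case False
  then have "red c v" "green c u" using assms by (auto simp: red_def green_def)
  then show thesis using that[of v u] by blast
qed

text \<open>The absence of charged pairs is expressed by a cardinality \<open>0\<close>, which would also hold for an infinite
  set; finiteness of the cube rules this out. Since every two-element set is charged or neutral, only
  one pair is left.\<close>

lemma admissible_neutral_pairD:
  assumes "admissible c n F 1 0 E"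
  obtains r g where "E = {{r, g}}" "red c r" "green c g" "r \<in> cube n - F" "g \<in> cube n - F"
proof -
  have "finite {e \<in> E. charged_pair e}" "card {e \<in> E. charged_pair e} = 0"
    using assms finite_admissible[OF assms] by (auto simp: admissible_def)
  then have nc: "\<not> charged_pair e" if "e \<in> E" for e using that by auto
  have n: "neutral_pair e" if "e \<in> E" for e
  proof -
    have "card e = 2" using assms that by (auto simp: admissible_def disjoint_pairs_def)
    then obtain u v where "e = {u, v}" "u \<noteq> v" by (auto simp: card_2_iff)
    with nc[OF that] show ?thesis by (auto simp: charged_pair_doubleton neutral_pair_doubleton)
  qed
  then have "{e \<in> E. neutral_pair e} = E" by auto
  then have "card E = 1" using assms by (simp add: admissible_def)
  then obtain e where e: "E = {e}" by (auto simp: card_1_singleton_iff)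
  with n obtain u v where "e = {u, v}" "even_vertex u \<noteq> even_vertex v"
    by (auto simp: neutral_pair_def)
  then obtain r g where rg: "e = {r, g}" "red c r" "green c g"
    using red_green_doubleton[of u v c] by metis
  have "r \<in> cube n - F" "g \<in> cube n - F"
    using finite_admissible(2)[OF assms] unfolding e rg(1) by blast+
  then show thesis using that e rg by simp
qed

lemma admissible_neutral_pair:
  assumes "r \<in> cube n - F" "g \<in> cube n - F" "red c r" "green c g" "signed_charge c F = 0"
  shows "admissible c n F 1 0 {{r, g}}"
proof -
  have "even_vertex r \<noteq> even_vertex g" using assms by (auto simp: red_def green_def)
  then have *: "neutral_pair {r, g}" "\<not> charged_pair {r, g}" "r \<noteq> g"
    by (auto simp: neutral_pair_doubleton charged_pair_doubleton)
  then have "\<not> green_pair c {r, g}" "\<not> red_pair c {r, g}"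
    by (auto simp: green_pair_def red_pair_def)
  with * show ?thesis
    using assms by (simp add: admissible_def in_balance_def disjoint_pairs_def cong: conj_cong)
qed

lemma ends_subset: "p \<noteq> [] \<Longrightarrow> ends p \<subseteq> set p"
  by (simp add: ends_def)

text \<open>Disjoint paths have disjoint sets of ends, so a covering all of whose paths have the ends \<open>{u, v}\<close>
  consists of a single path. It may be listed from \<open>v\<close> to \<open>u\<close>, which symmetry repairs.\<close>

lemma path_covering_single_iff:
  "(\<exists>P. path_covering n F P \<and> ends ` P = {{u, v}}) \<longleftrightarrow> ham_connected (cube n - F) u v"
proof
  assume "\<exists>P. path_covering n F P \<and> ends ` P = {{u, v}}"
  then obtain P where P: "path_covering n F P" "ends ` P = {{u, v}}" by blast
  then have ends: "ends q = {u, v}" if "q \<in> P" for q using imageI[OF that, of ends] by simp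
  from P(2) have "P \<noteq> {}" by force
  then obtain p where p: "p \<in> P" "ends p = {u, v}" using ends by blast
  have "q = p" if "q \<in> P" for q
  proof (rule ccontr)
    assume "q \<noteq> p"
    then have "disjnt (set q) (set p)"
      using P(1) that p(1) unfolding path_covering_def pairwise_def by blast
    moreover have "u \<in> ends q" "u \<in> ends p" using ends that p by simp_all
    moreover have "q \<noteq> []" "p \<noteq> []"
      using P(1) that p(1) unfolding path_covering_def is_path_def by blast+
    then have "ends q \<subseteq> set q" "ends p \<subseteq> set p" by (simp_all add: ends_subset)
    ultimately show False unfolding disjnt_def by blast
  qed
  then have "P = {p}" using p(1) by blast
  then have "is_path n F p" "set p = cube n - F"
    using P(1) by (simp_all add: path_covering_def)
  then have "ham_connected (cube n - F) (hd p) (last p)"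
    unfolding ham_connected_def is_path_def by blast
  moreover have "hd p = u \<and> last p = v \<or> hd p = v \<and> last p = u"
    using p(2) by (auto simp: ends_def doubleton_eq_iff)
  ultimately show "ham_connected (cube n - F) u v"
    using ham_connected_sym by blast
next
  assume "ham_connected (cube n - F) u v"
  then obtain p where "hamiltonian_path n F u v p" using hamiltonian_path_iff by blast
  then show "\<exists>P. path_covering n F P \<and> ends ` P = {{u, v}}"
    by (intro exI[of _ "{p}"]) (auto simp: hamiltonian_path_def path_covering_def ends_def)
qed

lemma neutral_fault_of_mass_2:
  assumes "is_fault c n 2 0 F"
  obtains r\<^sub>1 g\<^sub>1 where "F = {r\<^sub>1, g\<^sub>1}" "red c r\<^sub>1" "green c g\<^sub>1"
proof -
  obtain x y where F: "F = {x, y}" "x \<noteq> y" using assms by (auto simp: is_fault_def card_2_iff)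
  have "even_vertex x \<noteq> even_vertex y"
  proof
    assume "even_vertex x = even_vertex y"
    then have "red c v = red c x" if "v \<in> F" for v using that F(1) by (auto simp: red_def)
    then have "{v \<in> F. red c v} = (if red c x then F else {})"
      "{v \<in> F. green c v} = (if red c x then {} else F)"
      by (auto simp: green_def)
    then show False using assms by (auto simp: is_fault_def signed_charge_def split: if_splits)
  qed
  then show thesis using that red_green_doubleton[of x y c] unfolding F(1) by metis
qed

lemma signed_charge_neutral:
  assumes "red c r" "green c g"
  shows "signed_charge c {r, g} = 0"
proof -
  have "{v \<in> {r, g}. red c v} = {r}" "{v \<in> {r, g}. green c v} = {g}"
    using assms by (auto simp: green_def)
  then show ?thesis by (simp add: signed_charge_def)
qed

section \<open>The value of the bracket\<close>

lemma four_mem_A_set: "4 \<in> A_set c 2 0 1 0"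
proof -
  have "freely_prescribable c n F 1 0" if n: "n \<ge> 4" and fault: "is_fault c n 2 0 F" for n F
  proof -
    obtain r\<^sub>1 g\<^sub>1 where F: "F = {r\<^sub>1, g\<^sub>1}" "red c r\<^sub>1" "green c g\<^sub>1"
      using neutral_fault_of_mass_2[OF fault] .
    have sub: "F \<subseteq> cube n" using fault by (simp add: is_fault_def)
    have "(2 :: nat) ^ 2 \<le> 2 ^ (n - 1)" using n by (intro power_increasing) auto
    moreover have "finite F" "card F = 2" using fault by (auto simp: is_fault_def intro: finite_subset)
    ultimately have F': "finite F" "card F < 2 ^ (n - 1)" "n \<ge> 1" using n by auto
    obtain r where r: "r \<in> cube n" "even_vertex r = c" "r \<notin> F"
      using ex_vertex_of_parity[OF F'] by blast
    obtain g where g: "g \<in> cube n" "even_vertex g = (\<not> c)" "g \<notin> F"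
      using ex_vertex_of_parity[OF F'] by blast
    have "admissible c n F 1 0 {{r, g}}"
      using r g F signed_charge_neutral by (intro admissible_neutral_pair) (auto simp: red_def green_def)
    moreover have "\<exists>P. path_covering n F P \<and> ends ` P = E" if "admissible c n F 1 0 E" for E
    proof -
      obtain r g where E: "E = {{r, g}}" and rg: "red c r" "green c g" "r \<in> cube n - F" "g \<in> cube n - F"
        using admissible_neutral_pairD[OF \<open>admissible c n F 1 0 E\<close>] .
      have "ham_connected (cube n - F) r g"
        unfolding F(1)
      proof (rule ham_connected_minus_red_green_pair[where c = c])
        show "{r, r\<^sub>1, g, g\<^sub>1} \<subseteq> cube n" "r \<noteq> r\<^sub>1" "g \<noteq> g\<^sub>1" using rg F(1) sub by blast+
        show "\<not> exceptional n r\<^sub>1 g\<^sub>1 r g" using n by (simp add: exceptional_def)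
      qed (use n rg F in simp_all)
      then show ?thesis unfolding E path_covering_single_iff .
    qed
    ultimately show ?thesis unfolding freely_prescribable_def by blast
  qed
  moreover have "log 2 4 \<le> (4 :: real)"
    using log_pow_cancel[of 2 2] by simp
  ultimately show ?thesis by (simp add: A_set_def)
qed

text \<open>Deleting two antipodes from the three-dimensional cube leaves a hexagon, and a Hamiltonian path of a
  cycle ends next to its starting point. The two ends here are opposite, so a path that covered the
  hexagon would reach its end after three steps already.\<close>

lemma no_ham_path_hexagon:
  "\<not> ham_connected (cube 3 - {[False, False, False], [True, True, True]}) [True, False, False] [False, True, True]"
  (is "\<not> ham_connected ?S ?u ?v")
proof
  assume "ham_connected ?S ?u ?v"
  then obtain p where p: "p \<noteq> []" "distinct p" "set p = ?S" "successively adj p" "hd p = ?u" "last p = ?v"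
    by (auto simp: ham_connected_def)
  have "{[False, False, False], [True, True, True]} \<subseteq> cube 3" by (simp add: cube_def)
  then have "card ?S = 6" by (simp add: card_Diff_subset)
  then have "length p = 6" using p distinct_card[of p] by simp
  then obtain b c d e where p_eq: "p = [?u, b, c, d, e, ?v]"
  proof -
    from \<open>length p = 6\<close> obtain a b c d e f where abc: "p = [a, b, c, d, e, f]"
      by (auto simp: numeral_eq_Suc length_Suc_conv)
    have "a = ?u" "f = ?v" using p(5,6) unfolding abc by simp_all
    then show thesis using that abc by blast
  qed
  have adj: "adj ?u b" "adj b c" "adj c d" and distinct: "distinct [?u, b, c, d, e, ?v]"
    using p(2,4) unfolding p_eq by simp_all
  have "b \<in> set p" "c \<in> set p" "d \<in> set p" unfolding p_eq by simp_all
  then have verts: "b \<in> ?S" "c \<in> ?S" "d \<in> ?S" unfolding p(3) by simp_all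
  obtain b0 b1 b2 where b: "b = [b0, b1, b2]" using verts(1) cube_3_cases by blast
  obtain c0 c1 c2 where c: "c = [c0, c1, c2]" using verts(2) cube_3_cases by blast
  obtain d0 d1 d2 where d: "d = [d0, d1, d2]" using verts(3) cube_3_cases by blast
  have "b = [True, True, False] \<or> b = [True, False, True]"
    using verts(1) adj(1) unfolding b adj_cube_3 by auto
  then have "b = [True, True, False] \<and> c = [False, True, False] \<or>
      b = [True, False, True] \<and> c = [False, False, True]"
    using verts(2) adj(2) distinct unfolding b c adj_cube_3 by auto
  \<comment> \<open>The only continuation of the path other than going back.\<close>
  then have "d = ?v"
    using verts(3) adj(3) distinct unfolding b c d adj_cube_3 by auto
  then show False using distinct by simp
qed

text \<open>The hexagon refutes \<open>n = 3\<close>, and every \<open>m < 4\<close> has to admit \<open>n = 3\<close>. The set of the two faults and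
  the set of the two ends do not depend on the colouring, only the names red and green do; hence the
  colours are assigned afterwards.\<close>

lemma A_set_lower_bound: "m \<in> A_set c 2 0 1 0 \<Longrightarrow> m \<ge> 4"
proof (rule ccontr)
  assume m: "m \<in> A_set c 2 0 1 0" "\<not> m \<ge> 4"
  let ?O = "[False, False, False]" and ?I = "[True, True, True]"
  let ?u = "[True, False, False]" and ?v = "[False, True, True]"
  have par: "even_vertex ?O \<noteq> even_vertex ?I" "even_vertex ?u \<noteq> even_vertex ?v" by auto
  obtain r\<^sub>1 g\<^sub>1 where F: "{?O, ?I} = {r\<^sub>1, g\<^sub>1}" "red c r\<^sub>1" "green c g\<^sub>1"
    using red_green_doubleton[OF par(1)] .
  obtain r g where E: "{?u, ?v} = {r, g}" "red c r" "green c g"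
    using red_green_doubleton[OF par(2)] .
  have charge: "signed_charge c {?O, ?I} = 0" using F signed_charge_neutral by metis
  then have "is_fault c 3 2 0 {?O, ?I}" by (auto simp: is_fault_def cube_def)
  then have "freely_prescribable c 3 {?O, ?I} 1 0"
    using m by (auto simp: A_set_def)
  moreover have "r \<in> {?u, ?v}" "g \<in> {?u, ?v}" using E(1) by auto
  then have "r \<in> cube 3 - {?O, ?I}" "g \<in> cube 3 - {?O, ?I}"
    by (auto simp: cube_def)
  then have "admissible c 3 {?O, ?I} 1 0 {{?u, ?v}}"
    unfolding E(1) using E charge by (intro admissible_neutral_pair)
  ultimately have "\<exists>P. path_covering 3 {?O, ?I} P \<and> ends ` P = {{?u, ?v}}"
    by (simp add: freely_prescribable_def)
  then show False using no_ham_path_hexagon by (simp only: path_covering_single_iff)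
qed

theorem lemma3p6:
  fixes c :: bool
  shows "bracket c 2 0 1 0 = Some 4 \<and>
    (\<forall>n r r\<^sub>1 g g\<^sub>1.
       n \<ge> 2 \<longrightarrow>
       {r, r\<^sub>1, g, g\<^sub>1} \<subseteq> cube n \<longrightarrow>
       red c r \<longrightarrow> red c r\<^sub>1 \<longrightarrow> r \<noteq> r\<^sub>1 \<longrightarrow>
       green c g \<longrightarrow> green c g\<^sub>1 \<longrightarrow> g \<noteq> g\<^sub>1 \<longrightarrow>
       ((n = 2 \<or> n \<ge> 4 \<longrightarrow> (\<exists>p. hamiltonian_path n {r\<^sub>1, g\<^sub>1} r g p)) \<and>
        (n = 3 \<longrightarrow> {r, g} \<notin> bad_pairs c r\<^sub>1 g\<^sub>1 \<longrightarrow>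
           (\<exists>p. hamiltonian_path n {r\<^sub>1, g\<^sub>1} r g p))))"
proof (intro conjI allI impI)
  have "(LEAST m. m \<in> A_set c 2 0 1 0) = 4"
    by (intro Least_equality four_mem_A_set A_set_lower_bound)
  then show "bracket c 2 0 1 0 = Some 4"
    using four_mem_A_set by (auto simp: bracket_def)
next
  fix n r r\<^sub>1 g g\<^sub>1
  assume "n \<ge> 2" and V: "{r, r\<^sub>1, g, g\<^sub>1} \<subseteq> cube n" "r \<noteq> r\<^sub>1" "g \<noteq> g\<^sub>1"
    and col: "red c r" "red c r\<^sub>1" "green c g" "green c g\<^sub>1"
  have path: "\<exists>p. hamiltonian_path n {r\<^sub>1, g\<^sub>1} r g p" if "\<not> exceptional n r\<^sub>1 g\<^sub>1 r g"
    unfolding hamiltonian_path_iff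
    by (rule ham_connected_minus_red_green_pair[OF \<open>n \<ge> 2\<close> V col that])
  show "\<exists>p. hamiltonian_path n {r\<^sub>1, g\<^sub>1} r g p" if "n = 2 \<or> n \<ge> 4"
    by (rule path) (use that in \<open>auto simp: exceptional_def\<close>)
  show "\<exists>p. hamiltonian_path n {r\<^sub>1, g\<^sub>1} r g p" if "n = 3" "{r, g} \<notin> bad_pairs c r\<^sub>1 g\<^sub>1"
    using exceptional_imp_bad_pairs[OF _ V(1,2) col] that(2) by (intro path) blast
qed

end
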